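(* Let $F$ be a unitary operator on $\ell^2(\mathbb{N})$ and let $\mathcal{U}\subseteq\ell^2(\mathbb{N})$, $\mathcal{U}\not\subseteq\{0\}$, be a finite union of convex cones contained in a finite-dimensional subspace, with local coherence $\alpha=(\alpha_j)_{j\in\mathbb{N}}$ with respect to $F$. Then the minimum of $\mu_{\mathcal{U}}(F,p)$ over all admissible probability distributions $p$ on $\mathbb{N}$ is achieved by $p^*$, where $$p^*_j=\frac{\alpha_j^2}{\|\alpha\|^2},\qquad j\in\mathbb{N},$$ in which case $\mu_{\mathcal{U}}(F,p^* )^2=\|\alpha\|^2$. Here $\|\cdot\|$ is the $\ell^2(\mathbb{N})$ norm.
   Context: $\ell^2(\mathbb{N})$ is the complex Hilbert space of square-summable sequences. For a finite union of convex cones $\mathcal{U}=\bigcup_{i=1}^N\mathcal{C}_i\subseteq\ell^2(\mathbb{N})$ contained in a finite-dimensional subspace, let $\Delta(\mathcal{U})=\bigcup_{i=1}^N\operatorname{span}(\mathcal{C}_i)$ (this set does not depend on the decomposition). The local coherence of $\mathcal{U}$ with respect to $F$ is $\alpha_j=\sup_{x\in\Delta(\mathcal{U}),\|x\|=1}|(Fx)_j|$, $j\in\mathbb{N}$; the sequence $\alpha$ belongs to $\ell^2(\mathbb{N})$. For a probability distribution $p$ on $\mathbb{N}$, $\mu_{\mathcal{U}}(F,p)$ is the smallest constant such that $\alpha_j\le\mu_{\mathcal{U}}(F,p)\sqrt{p_j}$ for all $j$ with $p_j>0$ (it is $+\infty$ if there is no such finite constant). $p$ is called admissible if $\mu_{\mathcal{U}}(F,p)$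 is finite and $\alpha_j\le\mu_{\mathcal{U}}(F,p)\sqrt{p_j}$ holds for all $j\in\mathbb{N}$. *)

theory Defs
  imports "HOL-Probability.Probability"
begin

section \<open>The complex Hilbert space of square-summable sequences\<close>

definition l2_summable :: "(nat \<Rightarrow> 'a::real_normed_vector) \<Rightarrow> bool" where
  "l2_summable x \<longleftrightarrow> summable (\<lambda>n. (norm (x n))\<^sup>2)"

definition l2_norm :: "(nat \<Rightarrow> 'a::real_normed_vector) \<Rightarrow> real" where
  "l2_norm x = sqrt (\<Sum>n. (norm (x n))\<^sup>2)"

lemma l2_summable_add:
  assumes "l2_summable x" "l2_summable y"
  shows "l2_summable (\<lambda>n. x n + y n)"
proof -
  have "(norm (x n + y n))\<^sup>2 \<le> 2 * (norm (x n))\<^sup>2 + 2 * (norm (y n))\<^sup>2" for n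
  proof -
    have "(norm (x n + y n))\<^sup>2 \<le> (norm (x n) + norm (y n))\<^sup>2"
      by (intro power_mono norm_triangle_ineq norm_ge_zero)
    also have "\<dots> \<le> 2 * (norm (x n))\<^sup>2 + 2 * (norm (y n))\<^sup>2"
      using sum_squares_bound[of "norm (x n)" "norm (y n)"] by (simp add: power2_sum)
    finally show ?thesis .
  qed
  moreover have "summable (\<lambda>n. 2 * (norm (x n))\<^sup>2 + 2 * (norm (y n))\<^sup>2)"
    using assms unfolding l2_summable_def by (rule summable_add[OF summable_mult summable_mult])
  ultimately show ?thesis
    unfolding l2_summable_def by - (rule summable_comparison_test'[where N = 0], auto)
qed

lemma l2_summable_mult:
  fixes x :: "nat \<Rightarrow> complex"
  assumes "l2_summable x"
  shows "l2_summable (\<lambda>n. c * x n)"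
  using summable_mult[OF assms[unfolded l2_summable_def], of "(cmod c)\<^sup>2"]
  by (simp only: l2_summable_def norm_mult power_mult_distrib)

typedef ell2 = "{x :: nat \<Rightarrow> complex. l2_summable x}"
  morphisms coord Abs_ell2
  by (rule exI[of _ "\<lambda>_. 0"]) (simp add: l2_summable_def)

setup_lifting type_definition_ell2

lemma l2_summable_coord [simp]: "l2_summable (coord x)"
  using coord[of x] by simp

lemma ell2_eq_iff: "x = y \<longleftrightarrow> (\<forall>n. coord x n = coord y n)"
  by (metis coord_inject ext)

lift_definition scaleC :: "complex \<Rightarrow> ell2 \<Rightarrow> ell2" is "\<lambda>c x n. c * x n"
  by (rule l2_summable_mult)

lemma summable_cinner:
  assumes "l2_summable x" "l2_summable y"
  shows "summable (\<lambda>n. x n * cnj (y n))"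
proof (rule summable_comparison_test'[where N = 0])
  show "summable (\<lambda>n. (norm (x n))\<^sup>2 + (norm (y n))\<^sup>2)"
    using assms unfolding l2_summable_def by (rule summable_add)
  show "norm (x n * cnj (y n)) \<le> (norm (x n))\<^sup>2 + (norm (y n))\<^sup>2" for n
    using sum_squares_bound[of "norm (x n)" "norm (y n)"]
      mult_nonneg_nonneg[OF norm_ge_zero norm_ge_zero, of "x n" "y n"]
    unfolding norm_mult complex_mod_cnj by linarith
qed

definition cinner :: "ell2 \<Rightarrow> ell2 \<Rightarrow> complex" where
  "cinner x y = (\<Sum>n. coord x n * cnj (coord y n))"

instantiation ell2 :: real_inner
begin

lift_definition zero_ell2 :: ell2 is "\<lambda>_. 0"
  by (simp add: l2_summable_def)

lift_definition plus_ell2 :: "ell2 \<Rightarrow> ell2 \<Rightarrow> ell2" is "\<lambda>x y n. x n + y n"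
  by (rule l2_summable_add)

lift_definition uminus_ell2 :: "ell2 \<Rightarrow> ell2" is "\<lambda>x n. - x n"
  by (simp add: l2_summable_def)

lift_definition minus_ell2 :: "ell2 \<Rightarrow> ell2 \<Rightarrow> ell2" is "\<lambda>x y n. x n - y n"
proof -
  fix x y :: "nat \<Rightarrow> complex"
  assume "l2_summable x" "l2_summable y"
  then have "l2_summable (\<lambda>n. x n + - y n)"
    by (intro l2_summable_add) (simp_all add: l2_summable_def)
  then show "l2_summable (\<lambda>n. x n - y n)" by simp
qed

definition scaleR_ell2 :: "real \<Rightarrow> ell2 \<Rightarrow> ell2" where
  "scaleR_ell2 r x = scaleC (complex_of_real r) x"

definition norm_ell2 :: "ell2 \<Rightarrow> real" where
  "norm_ell2 x = l2_norm (coord x)"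

definition inner_ell2 :: "ell2 \<Rightarrow> ell2 \<Rightarrow> real" where
  "inner_ell2 x y = Re (cinner x y)"

definition sgn_ell2 :: "ell2 \<Rightarrow> ell2" where
  "sgn_ell2 x = scaleR (inverse (norm x)) x"

definition dist_ell2 :: "ell2 \<Rightarrow> ell2 \<Rightarrow> real" where
  "dist_ell2 x y = norm (x - y)"

definition uniformity_ell2 :: "(ell2 \<times> ell2) filter" where
  "uniformity_ell2 = (INF e\<in>{0 <..}. principal {(x, y). dist x y < e})"

definition open_ell2 :: "ell2 set \<Rightarrow> bool" where
  "open_ell2 U \<longleftrightarrow> (\<forall>x\<in>U. eventually (\<lambda>(x', y). x' = x \<longrightarrow> y \<in> U) uniformity)"

lemma inner_ell2_sums: "(\<lambda>n. Re (coord x n * cnj (coord y n))) sums inner x y"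
  for x y :: ell2
  unfolding inner_ell2_def cinner_def
  by (rule sums_Re[OF summable_sums[OF
        summable_cinner[OF l2_summable_coord l2_summable_coord]]])

lemma inner_self_ell2: "inner x x = (\<Sum>n. (norm (coord x n))\<^sup>2)" for x :: ell2
proof -
  have "Re (z * cnj z) = (norm z)\<^sup>2" for z :: complex
    unfolding complex_norm_square[symmetric] by (rule Re_complex_of_real)
  then show ?thesis
    using sums_unique[OF inner_ell2_sums[of x x]] by simp
qed

instance
proof
  fix a b r :: real and x y z :: ell2
  show "x + y + z = x + (y + z)" by transfer (simp add: algebra_simps)
  show "x + y = y + x" by transfer (simp add: algebra_simps)
  show "0 + x = x" by transfer simp
  show "- x + x = 0" by transfer simp
  show "x - y = x + - y" by transfer simp
  show "a *\<^sub>R (x + y) = a *\<^sub>R x + a *\<^sub>R y"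
    unfolding scaleR_ell2_def by transfer (simp add: algebra_simps)
  show "(a + b) *\<^sub>R x = a *\<^sub>R x + b *\<^sub>R x"
    unfolding scaleR_ell2_def by transfer (simp add: algebra_simps)
  show "a *\<^sub>R b *\<^sub>R x = (a * b) *\<^sub>R x"
    unfolding scaleR_ell2_def by transfer (simp add: algebra_simps)
  show "1 *\<^sub>R x = x"
    unfolding scaleR_ell2_def by transfer simp
  show "dist x y = norm (x - y)" by (rule dist_ell2_def)
  show "sgn x = scaleR (inverse (norm x)) x" by (rule sgn_ell2_def)
  show "(uniformity :: (ell2 \<times> ell2) filter) = (INF e\<in>{0 <..}. principal {(x, y). dist x y < e})"
    by (rule uniformity_ell2_def)
  show "open U \<longleftrightarrow> (\<forall>x\<in>U. eventually (\<lambda>(x', y). x' = x \<longrightarrow> y \<in> U) uniformity)"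
    for U :: "ell2 set" by (rule open_ell2_def)
  show "inner x y = inner y x"
    using sums_unique2[OF inner_ell2_sums[of x y]] inner_ell2_sums[of y x]
    by (simp add: mult.commute)
  show "inner (x + y) z = inner x z + inner y z"
    using sums_unique2[OF inner_ell2_sums[of "x + y" z]]
      sums_add[OF inner_ell2_sums[of x z] inner_ell2_sums[of y z]]
    by (simp add: plus_ell2.rep_eq algebra_simps)
  show "inner (r *\<^sub>R x) y = r * inner x y"
    using sums_unique2[OF inner_ell2_sums[of "r *\<^sub>R x" y]]
      sums_mult[OF inner_ell2_sums[of x y], of r]
    by (simp add: scaleR_ell2_def scaleC.rep_eq algebra_simps)
  have s: "summable (\<lambda>n. (norm (coord x n))\<^sup>2)"
    using l2_summable_coord[of x] by (simp add: l2_summable_def)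
  show "0 \<le> inner x x"
    unfolding inner_self_ell2 by (intro suminf_nonneg s) simp
  show "inner x x = 0 \<longleftrightarrow> x = 0"
    unfolding inner_self_ell2 using suminf_eq_zero_iff[OF s]
    by (simp add: ell2_eq_iff zero_ell2.rep_eq)
  show "norm x = sqrt (inner x x)"
    unfolding inner_self_ell2 norm_ell2_def l2_norm_def ..
qed

end

global_interpretation cell2: vector_space scaleC
  by unfold_locales
    (simp_all add: ell2_eq_iff scaleC.rep_eq plus_ell2.rep_eq distrib_left distrib_right mult.assoc)

text \<open>The unqualified \<open>span\<close> is the real span; here the span is complex.\<close>

abbreviation cspan :: "ell2 set \<Rightarrow> ell2 set" where
  "cspan \<equiv> cell2.span"

definition finite_dim_csubspace :: "ell2 set \<Rightarrow> bool" where
  "finite_dim_csubspace V \<longleftrightarrow> (\<exists>B. finite B \<and> V = cspan B)"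

definition unitary_operator :: "(ell2 \<Rightarrow> ell2) \<Rightarrow> bool" where
  "unitary_operator F \<longleftrightarrow>
     Vector_Spaces.linear scaleC scaleC F \<and> bij F \<and>
     (\<forall>x y. cinner (F x) (F y) = cinner x y)"

section \<open>Local coherence and admissible distributions\<close>

text \<open>
  The set \<open>\<Delta>(\<U>)\<close> of a union of cones is computed from the family of cones. It depends only on
  the union of the family, so quantifying over the family loses nothing.
\<close>

definition Delta :: "nat \<Rightarrow> (nat \<Rightarrow> ell2 set) \<Rightarrow> ell2 set" where
  "Delta N C = (\<Union>i\<in>{1..N}. cspan (C i))"

text \<open>
  The supremum is over a set bounded by 1 when \<open>F\<close> is unitary, and nonempty when \<open>D\<close> is a union
  of subspaces, not all zero.
\<close>

definition local_coherence :: "(ell2 \<Rightarrow> ell2) \<Rightarrow> ell2 set \<Rightarrow> nat \<Rightarrow> real" where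
  "local_coherence F D j = (SUP x\<in>{x \<in> D. norm x = 1}. cmod (coord (F x) j))"

text \<open>
  In the extended reals, the infimum over an empty set of constants is \<open>\<infinity>\<close>. Otherwise the infimum
  is attained and nonnegative, since \<open>\<alpha> \<ge> 0\<close> and \<open>p\<close> has nonempty support.
\<close>

definition coherence_const :: "(nat \<Rightarrow> real) \<Rightarrow> nat pmf \<Rightarrow> ereal" where
  "coherence_const \<alpha> p =
     Inf (ereal ` {c. \<forall>j. pmf p j > 0 \<longrightarrow> \<alpha> j \<le> c * sqrt (pmf p j)})"

definition admissible :: "(nat \<Rightarrow> real) \<Rightarrow> nat pmf \<Rightarrow> bool" where
  "admissible \<alpha> p \<longleftrightarrow>
     \<bar>coherence_const \<alpha> p\<bar> \<noteq> \<infinity> \<and>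
     (\<forall>j. ereal (\<alpha> j) \<le> coherence_const \<alpha> p * ereal (sqrt (pmf p j)))"

end

theory Submission
  imports Defs
begin

text \<open>
  Gram-Schmidt gives a finite family \<open>E\<close>, orthogonal for the real inner product, whose real span
  contains \<open>\<Delta>(\<U>)\<close>. A unit vector in this span has coefficient at most \<open>1 / \<parallel>e\<parallel>\<close> at \<open>e\<close>, so
  \<open>\<alpha>\<^sub>j \<le> \<Sum>e\<in>E. \<bar>(F e)\<^sub>j\<bar> / \<parallel>e\<parallel>\<close> and \<open>\<alpha>\<close> is square summable. If \<open>\<mu>\<close> is the constant of an admissible
  \<open>p\<close>, summing \<open>\<alpha>\<^sub>j\<^sup>2 \<le> \<mu>\<^sup>2 p\<^sub>j\<close> over \<open>j\<close> gives \<open>\<parallel>\<alpha>\<parallel>\<^sup>2 \<le> \<mu>\<^sup>2\<close>, with equality for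
  \<open>p\<^sub>j = \<alpha>\<^sub>j\<^sup>2 / \<parallel>\<alpha>\<parallel>\<^sup>2\<close>.
\<close>

text \<open>Pairing \<open>x\<close> with \<open>e\<close> isolates its coefficient
  \<open>r e\<close>, which Cauchy-Schwarz bounds by \<open>norm x / norm e\<close>; linearity and
  the triangle inequality then give the estimate.\<close>

lemma norm_linear_le_on_orthogonal_span:
  fixes f :: "'a::real_inner \<Rightarrow> 'b::real_normed_vector"
  assumes "linear f" "finite E" "pairwise orthogonal E" "x \<in> span E"
  shows "norm (f x) \<le> norm x * (\<Sum>e\<in>E. norm (f e) / norm e)"
proof -
  obtain r where x: "x = (\<Sum>e\<in>E. r e *\<^sub>R e)"
    using assms(4) span_finite[OF assms(2)] by auto
  have bound: "norm (r e *\<^sub>R f e) \<le> norm x * (norm (f e) / norm e)" if e: "e \<in> E" for e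
  proof (cases "e = 0")
    \<comment> \<open>Pairwise orthogonality allows \<open>0\<close> in \<open>E\<close>; its term
      vanishes on both sides, since \<open>f 0 = 0\<close> and division by zero yields 0.\<close>
    case True
    then show ?thesis using linear_0[OF assms(1)] by simp
  next
    case False
    have "inner x e = (\<Sum>d\<in>E. if d = e then r e * inner e e else 0)"
      unfolding x inner_sum_left using assms(3) e
      by (intro sum.cong) (auto simp: pairwise_def orthogonal_def)
    then have "inner x e = r e * (norm e)\<^sup>2"
      using e assms(2) by (simp add: power2_norm_eq_inner)
    then have "\<bar>r e\<bar> * (norm e)\<^sup>2 \<le> norm x * norm e"
      using Cauchy_Schwarz_ineq2[of x e] by (simp add: abs_mult)
    then have "\<bar>r e\<bar> \<le> norm x / norm e"
      using False by (simp add: power2_eq_square field_simps)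
    then show ?thesis
      using mult_right_mono[of "\<bar>r e\<bar>" "norm x / norm e" "norm (f e)"] by simp
  qed
  have "f x = (\<Sum>e\<in>E. r e *\<^sub>R f e)"
    unfolding x by (simp add: linear_sum[OF assms(1)] linear_scale[OF assms(1)])
  then have "norm (f x) \<le> (\<Sum>e\<in>E. norm (r e *\<^sub>R f e))"
    by (simp only: norm_sum)
  also have "\<dots> \<le> (\<Sum>e\<in>E. norm x * (norm (f e) / norm e))"
    by (intro sum_mono bound)
  finally show ?thesis by (simp add: sum_distrib_left)
qed

text \<open>Splitting complex coefficients into real and imaginary parts reduces to a finite real
  spanning set, to which the real Gram-Schmidt theorem \<open>basis_orthogonal\<close>
  applies.\<close>

lemma cspan_finite_subset_span:
  assumes "finite B"
  shows "cspan B \<subseteq> span (B \<union> scaleC \<i> ` B)"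
proof
  fix x assume "x \<in> cspan B"
  then obtain u where x: "x = (\<Sum>b\<in>B. scaleC (u b) b)"
    using cell2.span_finite[OF assms] by auto
  have "scaleC c b \<in> span (B \<union> scaleC \<i> ` B)" if "b \<in> B" for c b
  proof -
    have "scaleC c b = Re c *\<^sub>R b + Im c *\<^sub>R scaleC \<i> b"
      by (simp add: ell2_eq_iff scaleR_ell2_def scaleC.rep_eq plus_ell2.rep_eq complex_eq_iff)
    also have "\<dots> \<in> span (B \<union> scaleC \<i> ` B)"
      using that by (intro span_add span_scale span_base) auto
    finally show ?thesis .
  qed
  then show "x \<in> span (B \<union> scaleC \<i> ` B)"
    unfolding x by (intro span_sum)
qed

lemma linear_coord:
  assumes "Vector_Spaces.linear scaleC scaleC F"
  shows "linear (\<lambda>x. coord (F x) j)"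
proof -
  interpret F: Vector_Spaces.linear scaleC scaleC F by fact
  show ?thesis
    by (rule linearI)
      (simp_all add: F.add F.scale scaleR_ell2_def plus_ell2.rep_eq scaleC.rep_eq scaleR_conv_of_real)
qed

lemma l2_summable_sum:
  assumes "finite A" "\<And>a. a \<in> A \<Longrightarrow> l2_summable (f a)"
  shows "l2_summable (\<lambda>n. \<Sum>a\<in>A. f a n)"
  using assms
proof (induction A rule: finite_induct)
  case empty
  show ?case by (simp add: l2_summable_def)
next
  case (insert a A)
  then show ?case by (simp add: l2_summable_add)
qed

text \<open>The majorant \<open>g\<close> does not depend on \<open>x\<close>, so it both bounds the
  set under the supremum defining the coherence and dominates that supremum. It is square summable
  as a finite sum of scaled moduli of the sequences \<open>F e\<close>.\<close>

lemma cspan_coord_bound: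
  assumes "Vector_Spaces.linear scaleC scaleC F" "finite B"
  obtains g :: "nat \<Rightarrow> real" where "l2_summable g"
    "\<And>x j. x \<in> cspan B \<Longrightarrow> norm x = 1 \<Longrightarrow> cmod (coord (F x) j) \<le> g j"
proof -
  obtain E where E: "finite E" "span E = span (B \<union> scaleC \<i> ` B)" "pairwise orthogonal E"
    using basis_orthogonal[of "B \<union> scaleC \<i> ` B"] assms(2) by auto
  define g where "g j = (\<Sum>e\<in>E. cmod (coord (F e) j) / norm e)" for j
  have "l2_summable (\<lambda>j. cmod (coord (F e) j) / norm e)" for e
    using summable_divide[of "\<lambda>j. (cmod (coord (F e) j))\<^sup>2" "(norm e)\<^sup>2"] l2_summable_coord[of "F e"]
    by (simp add: l2_summable_def power_divide)
  then have "l2_summable g"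
    unfolding g_def using E(1) by (intro l2_summable_sum)
  moreover have "cmod (coord (F x) j) \<le> g j" if "x \<in> cspan B" "norm x = 1" for x j
  proof -
    have "x \<in> span E"
      using that(1) cspan_finite_subset_span[OF assms(2)] E(2) by auto
    from norm_linear_le_on_orthogonal_span[OF linear_coord[OF assms(1)] E(1,3) this] that(2)
    show ?thesis by (simp add: g_def)
  qed
  ultimately show ?thesis by (rule that)
qed

lemma l2_norm_real_power2: "(l2_norm f)\<^sup>2 = (\<Sum>j. (f j)\<^sup>2)" if "l2_summable f"
  for f :: "nat \<Rightarrow> real"
  using that by (simp add: l2_norm_def l2_summable_def suminf_nonneg)

lemma pmf_sums_1: "pmf p sums 1" for p :: "nat pmf"
proof -
  have "summable (pmf p)"
    using pmf_abs_summable[of p UNIV] by (simp add: abs_summable_on_nat_iff')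
  moreover have "(\<Sum>j. pmf p j) = 1"
    using infsetsum_nat'[OF pmf_abs_summable[of p UNIV]] infsetsum_pmf_eq_1[of p UNIV] by simp
  ultimately show ?thesis by (simp add: sums_iff)
qed

context
  fixes \<alpha> :: "nat \<Rightarrow> real"
  assumes nonneg: "\<And>j. 0 \<le> \<alpha> j" and summable: "l2_summable \<alpha>" and nonzero: "\<exists>j. \<alpha> j \<noteq> 0"
begin

lemma l2_norm_pos: "0 < l2_norm \<alpha>"
proof -
  obtain j where "0 < (\<alpha> j)\<^sup>2"
    using nonzero by auto
  then have "0 < (\<Sum>j. (\<alpha> j)\<^sup>2)"
    using summable by (intro suminf_pos2[where i = j]) (auto simp: l2_summable_def)
  then show ?thesis by (simp add: l2_norm_def)
qed

lemma admissible_ge_l2_norm: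
  assumes "admissible \<alpha> p"
  shows "ereal (l2_norm \<alpha>) \<le> coherence_const \<alpha> p"
proof -
  obtain m where m: "coherence_const \<alpha> p = ereal m"
    using assms by (auto simp: admissible_def)
  have le: "\<alpha> j \<le> m * sqrt (pmf p j)" for j
    using assms by (auto simp: admissible_def m)
  \<comment> \<open>Comparing squares only bounds the norm by the absolute value of
    \<open>m\<close>, so the sign of \<open>m\<close> is settled first, at an index where the
    coherence is positive.\<close>
  obtain j where "\<alpha> j \<noteq> 0" using nonzero by blast
  then have "0 < m * sqrt (pmf p j)"
    using nonneg[of j] le[of j] by linarith
  then have "0 < m"
    by (simp add: zero_less_mult_iff)
  have "(\<alpha> j)\<^sup>2 \<le> m\<^sup>2 * pmf p j" for j
    using power_mono[OF le nonneg, of j 2] by (simp add: power_mult_distrib)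
  then have "(\<Sum>j. (\<alpha> j)\<^sup>2) \<le> m\<^sup>2"
    using suminf_le[of "\<lambda>j. (\<alpha> j)\<^sup>2" "\<lambda>j. m\<^sup>2 * pmf p j"] summable
      sums_mult[OF pmf_sums_1, of "m\<^sup>2" p]
    by (auto simp: l2_summable_def sums_iff)
  then have "(l2_norm \<alpha>)\<^sup>2 \<le> m\<^sup>2"
    by (simp add: l2_norm_real_power2[OF summable])
  then show ?thesis
    using \<open>0 < m\<close> power2_le_imp_le[of "l2_norm \<alpha>" m] by (simp add: m)
qed

lemma ex_pmf_normalized_squares:
  "\<exists>p :: nat pmf. \<forall>j. pmf p j = (\<alpha> j)\<^sup>2 / (l2_norm \<alpha>)\<^sup>2"
proof -
  let ?f = "\<lambda>j. (\<alpha> j)\<^sup>2 / (l2_norm \<alpha>)\<^sup>2"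
  have "?f sums 1"
    using sums_divide[OF summable_sums, of "\<lambda>j. (\<alpha> j)\<^sup>2" "(l2_norm \<alpha>)\<^sup>2"] summable l2_norm_pos
    by (simp add: l2_summable_def flip: l2_norm_real_power2)
  then have "(\<integral>\<^sup>+ j. ennreal (?f j) \<partial>count_space UNIV) = 1"
    by (simp add: nn_integral_count_space_nat suminf_ennreal2 sums_iff)
  then have "pmf (embed_pmf ?f) j = ?f j" for j
    by (intro pmf_embed_pmf) auto
  then show ?thesis by blast
qed

text \<open>Here \<open>\<alpha> j\<close> equals \<open>l2_norm \<alpha> * sqrt (pmf p j)\<close>
  for every \<open>j\<close>, so the defining inequalities are equalities at the constant
  \<open>l2_norm \<alpha>\<close>, also off the support of \<open>p\<close>.\<close>

lemma
  assumes p: "\<And>j. pmf p j = (\<alpha> j)\<^sup>2 / (l2_norm \<alpha>)\<^sup>2"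
  shows coherence_const_normalized_squares: "coherence_const \<alpha> p = ereal (l2_norm \<alpha>)"
    and admissible_normalized_squares: "admissible \<alpha> p"
proof -
  have sqrt: "sqrt (pmf p j) = \<alpha> j / l2_norm \<alpha>" for j
    using l2_norm_pos nonneg[of j] by (simp add: p real_sqrt_divide)
  \<comment> \<open>Zero entries put no condition on \<open>c\<close>. Each nonzero entry gives the
    same half-line, and one such entry exists, so the infimum is its endpoint.\<close>
  have "\<alpha> j \<le> c * sqrt (pmf p j) \<longleftrightarrow> \<alpha> j = 0 \<or> c \<in> {l2_norm \<alpha>..}" for j c
  proof (cases "\<alpha> j = 0")
    case False
    then have "0 < \<alpha> j" using nonneg[of j] by simp
    then show ?thesis using l2_norm_pos by (simp add: sqrt field_simps)
  qed (simp add: sqrt)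
  moreover have "pmf p j > 0 \<longleftrightarrow> \<alpha> j \<noteq> 0" for j
    using l2_norm_pos by (simp add: p zero_less_divide_iff)
  ultimately have "{c. \<forall>j. pmf p j > 0 \<longrightarrow> \<alpha> j \<le> c * sqrt (pmf p j)} = {l2_norm \<alpha>..}"
    using nonzero by blast
  then show const: "coherence_const \<alpha> p = ereal (l2_norm \<alpha>)"
    unfolding coherence_const_def by (intro Inf_eqI) auto
  show "admissible \<alpha> p"
    using l2_norm_pos by (simp add: admissible_def const sqrt)
qed

end

theorem lemma2p2:
  fixes F :: "ell2 \<Rightarrow> ell2"
    and U :: "ell2 set"
    and C :: "nat \<Rightarrow> ell2 set"
    and N :: nat
    and \<alpha> :: "nat \<Rightarrow> real"
  assumes "unitary_operator F"
    and "\<forall>i\<in>{1..N}. convex_cone (C i)"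
    and "U = (\<Union>i\<in>{1..N}. C i)"
    and "\<not> U \<subseteq> {0}"
    and "\<exists>V. finite_dim_csubspace V \<and> U \<subseteq> V"
    and "\<alpha> = local_coherence F (Delta N C)"
  shows "\<exists>pstar :: nat pmf.
           (\<forall>j. pmf pstar j = (\<alpha> j)\<^sup>2 / (l2_norm \<alpha>)\<^sup>2) \<and>
           is_arg_min (coherence_const \<alpha>) (admissible \<alpha>) pstar \<and>
           (coherence_const \<alpha> pstar)\<^sup>2 = ereal ((l2_norm \<alpha>)\<^sup>2)"
proof -
  have F: "Vector_Spaces.linear scaleC scaleC F" and "inj F"
    using assms(1) by (auto simp: unitary_operator_def bij_def)
  let ?S = "{x \<in> Delta N C. norm x = 1}"
  obtain B where B: "finite B" "U \<subseteq> cspan B"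
    using assms(5) by (auto simp: finite_dim_csubspace_def)
  \<comment> \<open>Each cone lies in the complex subspace \<open>cspan B\<close>, hence so does its
    complex span.\<close>
  then have Delta: "Delta N C \<subseteq> cspan B"
    unfolding Delta_def assms(3) by (intro UN_least cell2.span_minimal cell2.subspace_span) blast
  obtain g :: "nat \<Rightarrow> real" where g: "l2_summable g"
    "\<And>x j. x \<in> cspan B \<Longrightarrow> norm x = 1 \<Longrightarrow> cmod (coord (F x) j) \<le> g j"
    by (rule cspan_coord_bound[OF F B(1)]) (rule that)
  then have bound: "cmod (coord (F x) j) \<le> g j" if "x \<in> ?S" for x j
    using that Delta by auto
  obtain i u where u: "i \<in> {1..N}" "u \<in> C i" "u \<noteq> 0"
    using assms(3,4) by blast
  \<comment> \<open>Real scaling is a case of complex scaling, so normalizing \<open>u\<close> stays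
    in the span of its cone. This unit vector makes the supremum one over a nonempty set.\<close>
  define x where "x = u /\<^sub>R norm u"
  have "x \<in> cspan (C i)"
    unfolding x_def scaleR_ell2_def using u(2) by (intro cell2.span_scale cell2.span_base)
  then have x: "x \<in> ?S"
    using u by (auto simp: Delta_def x_def)
  have upper: "cmod (coord (F x) j) \<le> \<alpha> j" for j
    unfolding assms(6) local_coherence_def
    by (rule cSUP_upper[OF x bdd_aboveI2[OF bound]])
  have nonneg: "0 \<le> \<alpha> j" for j
    by (rule order_trans[OF norm_ge_zero upper])
  have le: "\<alpha> j \<le> g j" for j
    unfolding assms(6) local_coherence_def by (rule cSUP_least[OF _ bound]) (use x in blast)
  have "norm ((norm (\<alpha> j))\<^sup>2) \<le> (norm (g j))\<^sup>2" for j
    using power_mono[OF le nonneg, of j 2] by simp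
  then have summable: "l2_summable \<alpha>"
    using g(1) summable_comparison_test'[of "\<lambda>j. (norm (g j))\<^sup>2" 0 "\<lambda>j. (norm (\<alpha> j))\<^sup>2"]
    unfolding l2_summable_def by blast
  have "x \<noteq> 0"
    using x by auto
  interpret F: Vector_Spaces.linear scaleC scaleC F by fact
  \<comment> \<open>Injectivity gives a nonzero coordinate of \<open>F x\<close>, and the coherence
    is at least its modulus there.\<close>
  have "F x \<noteq> 0"
    using \<open>inj F\<close> \<open>x \<noteq> 0\<close> F.zero by (metis injD)
  then obtain j where "coord (F x) j \<noteq> 0"
    by (auto simp: ell2_eq_iff zero_ell2.rep_eq)
  then have nonzero: "\<exists>j. \<alpha> j \<noteq> 0"
    using upper[of j] by (intro exI[of _ j]) auto
  note facts = nonneg summable nonzero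
  obtain p :: "nat pmf" where p: "\<And>j. pmf p j = (\<alpha> j)\<^sup>2 / (l2_norm \<alpha>)\<^sup>2"
    using ex_pmf_normalized_squares[OF facts] by blast
  have const: "coherence_const \<alpha> p = ereal (l2_norm \<alpha>)"
    by (rule coherence_const_normalized_squares[OF facts p])
  have "is_arg_min (coherence_const \<alpha>) (admissible \<alpha>) p"
    using admissible_normalized_squares[OF facts p] admissible_ge_l2_norm[OF facts]
    by (simp add: is_arg_min_def const not_less)
  with p const show ?thesis
    by (intro exI[of _ p]) simp
qed

end
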